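(* In the setting described in the context (smooth and strongly convex objectives $f_1,\dots,f_m$, bounded closed convex feasible region $\mathcal{X}$, bounds on the moments of the stochastic gradients, Lipschitz continuity of the subproblem solution), let $x_*$ be any point in $\mathcal{X}$ and let the step sizes be $\alpha_k=\frac{2}{c(k+1)}$. Then the sequence of iterates $\{x_k\}$ generated by the Stochastic Multi-Gradient algorithm satisfies, for every $k\ge 1$, $$\min_{s=1,\ldots,k}\mathbb{E}[S(x_s,\lambda_s)]-\mathbb{E}[S(x_*,\bar\lambda_k)]\;\le\;\frac{2L_g^2+4\Theta\,(L_{\nabla S}+\beta L_{\nabla S}M_S)}{c(k+1)},$$ where $\bar\lambda_k=\sum_{s=1}^k\frac{s}{\sum_{j=1}^k j}\,\lambda_s\in\Delta^m$.
   Context: **Problem.** Let $m\ge 2$, let $\mathcal{X}\subset\mathbb{R}^n$ be nonempty, closed and convex, let $w$ be a random variable whose distribution does not depend on $x$, and let $f_i:\mathbb{R}^n\to\mathbb{R}$, $f_i(x)=\mathbb{E}[f_i(x,w)]$, $i=1,\dots,m$. The stochastic multi-objective problem is to minimize $F(x)=(f_1(x),\dots,f_m(x))^\top$ over $x\in\mathcal{X}$. Norms are Euclidean. Let $\Delta^m=\{\lambda\in\mathbb{R}^m:\sum_{i=1}^m\lambda_i=1,\ \lambda_i\ge 0\ \forall i\}$ and $S(x,\lambda)=\sum_{i=1}^m\lambda_i f_i(x)$, so $\nabla_xS(x,\lambda)=\sum_{i=1}^m\lambda_i\nabla f_i(x)$. **Algorithm (Stochastic Multi-Gradient, SMG).**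 Let $\{w_k\}$ be independent copies of $w$ and $\{\alpha_k\}$ positive step sizes. Start from $x_0\in\mathcal{X}$. For $k=0,1,\dots$: compute stochastic gradients $g_i(x_k,w_k)\in\mathbb{R}^n$, $i=1,\dots,m$; compute $\lambda^g_k\in\operatorname{argmin}_{\lambda\in\Delta^m}\|\sum_{i=1}^m\lambda_i g_i(x_k,w_k)\|^2$; set $g(x_k,w_k)=\sum_{i=1}^m(\lambda^g_k)_i\,g_i(x_k,w_k)$; set $x_{k+1}=P_{\mathcal{X}}(x_k-\alpha_k g(x_k,w_k))$, where $P_{\mathcal{X}}$ is the orthogonal projection onto $\mathcal{X}$. In addition, $\lambda_k$ denotes the solution in the corresponding subproblem with true gradients: $\lambda_k\in\operatorname{argmin}_{\lambda\in\Delta^m}\|\sum_{i=1}^m\lambda_i\nabla f_i(x_k)\|^2$. $\mathbb{E}_{w_k}[\cdot]$ is the expectation with respect to $w_k$ ($x_k$ does not depend on $w_k$ and is held fixed), $\mathbb{V}_{w_k}[Y]=\mathbb{E}_{w_k}[\|Y\|^2]-\|\mathbb{E}_{w_k}[Y]\|^2$, and $\mathbb{E}[\cdot]$ is the expectation with respect to the joint distribution of $\{w_k\}$. **Assumptions.** 1. (Lipschitz gradients) Each $f_i$ is continuously differentiable and $\|\nabla f_i(x)-\nabla f_i(\bar x)\|\le L_i\|x-\bar x\|$ for all $x,\bar x\in\mathbb{R}^n$, with $L_i>0$. Put $L=\max_iL_i$. 2. (Stochastic gradients) For all $i$ and all iterates $k$: (a) $\mathbb{E}_{w_k}[g_i(x_k,w_k)]=\nabla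 f_i(x_k)$; (b) there are constants $C_i,\hat C_i>0$ (independent of $k$) with $\mathbb{E}_{w_k}[\|g_i(x_k,w_k)-\nabla f_i(x_k)\|]\le\alpha_k(C_i+\hat C_i\|\nabla f_i(x_k)\|)$; (c) there are constants $G_i,\hat G_i>0$ (independent of $k$) with $\mathbb{V}_{w_k}[g_i(x_k,w_k)]\le G_i^2+\hat G_i^2\|\nabla f_i(x_k)\|^2$. 3. (Bounded feasible region) $\mathcal{X}$ is bounded; $\Theta>0$ is a finite constant with $\max_{x,y\in\mathcal{X}}\|x-y\|\le\Theta$. 4. (Subproblem Lipschitz continuity) The optimal solution of $\min_{\lambda\in\Delta^m}\|\sum_i\lambda_iv_i\|^2$ is a Lipschitz function $\lambda(v_1,\dots,v_m)$ of the parameters, on the set of parameter tuples that arise (the tuples $(\nabla f_1(x),\dots,\nabla f_m(x))$, $x\in\mathcal{X}$, and the tuples of stochastic gradients $(g_1(x_k,w_k),\dots,g_m(x_k,w_k))$): there is $\beta>0$ with $\|\lambda(v_1,\dots,v_m)-\lambda(v_1',\dots,v_m')\|\le\beta\,\|[(v_1-v_1')^\top,\dots,(v_m-v_m')^\top]\|$ for all such tuples. Here $\lambda_k=\lambda(\nabla f_1(x_k),\dots,\nabla f_m(x_k))$ and $\lambda_k^g=\lambda(g_1(x_k,w_k),\dots,g_m(x_k,w_k))$. 5. (Strong convexity) For each $i$ there is $c_i>0$ with $f_i(\bar x)\ge f_i(x)+\nabla f_i(x)^\top(\bar x-x)+\frac{c_i}{2}\|\bar x-x\|^2$ for all $x,\bar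 x\in\mathbb{R}^n$. Put $c=\min_ic_i$. **Constants.** $M_\nabla$ is the largest of the norms $\|\nabla f_i\|$, $i=1,\dots,m$, at an arbitrary fixed point of $\mathcal{X}$; $M_1=\sum_{i=1}^mC_i$; $M_F=\max_i\hat C_i$; $G^2=m\sum_{i=1}^mG_i^2$; $G_V^2=m\max_i(\hat G_i^2+1)$; $L_{\nabla S}=M_1+mM_F(M_\nabla+L\Theta)$; $L_g^2=G^2+mG_V^2(M_\nabla+L\Theta)^2$; $M_S=\sqrt{mn}\,(M_\nabla+L\Theta)$. *)

theory Defs
  imports "HOL-Probability.Probability"
begin

definition unit_simplex :: "(real ^ 'm::finite) set" where
  "unit_simplex = {l. (\<Sum>i\<in>UNIV. l $ i) = 1 \<and> (\<forall>i. 0 \<le> l $ i)}"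

definition scalarization :: "('m::finite \<Rightarrow> 'x \<Rightarrow> real) \<Rightarrow> 'x \<Rightarrow> real ^ 'm \<Rightarrow> real" where
  "scalarization f x l = (\<Sum>i\<in>UNIV. l $ i * f i x)"

text \<open>A tuple of \<open>m\<close> vectors is an element of \<open>(real ^ 'n) ^ 'm\<close>; its library norm is the
  Euclidean norm of the concatenated vector.\<close>

definition combination :: "(real ^ 'n::finite) ^ 'm::finite \<Rightarrow> real ^ 'm \<Rightarrow> real ^ 'n" where
  "combination v l = (\<Sum>i\<in>UNIV. l $ i *\<^sub>R v $ i)"

definition subproblem_solution :: "(real ^ 'n::finite) ^ 'm::finite \<Rightarrow> real ^ 'm \<Rightarrow> bool" where
  "subproblem_solution v l \<longleftrightarrow>
     is_arg_min (\<lambda>l. (norm (combination v l))\<^sup>2) (\<lambda>l. l \<in> unit_simplex) l"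

text \<open>The library's \<open>variance\<close> is for real-valued random variables only. The value is meaningful
  only if \<open>Y\<close> is square-integrable (the Bochner integral of a non-integrable function is 0).\<close>

definition vec_variance :: "'w measure \<Rightarrow> ('w \<Rightarrow> real ^ 'n::finite) \<Rightarrow> real" where
  "vec_variance D Y = (LINT v|D. (norm (Y v))\<^sup>2) - (norm (LINT v|D. Y v))\<^sup>2"

text \<open>One run of the stochastic multi-gradient algorithm, for a given realization \<open>w\<close> of the
  samples: \<open>x\<close> is the sequence of iterates and \<open>lg\<close> the sequence of subproblem solutions for the
  stochastic gradients.  \<open>closest_point X\<close> is the orthogonal projection onto \<open>X\<close>.\<close>

definition smg_run ::
  "(real ^ 'n::finite) set \<Rightarrow> (nat \<Rightarrow> real) \<Rightarrow> ('m::finite \<Rightarrow> real ^ 'n \<Rightarrow> 'w \<Rightarrow> real ^ 'n) \<Rightarrow>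
   real ^ 'n \<Rightarrow> (nat \<Rightarrow> 'w) \<Rightarrow> (nat \<Rightarrow> real ^ 'n) \<Rightarrow> (nat \<Rightarrow> real ^ 'm) \<Rightarrow> bool" where
  "smg_run X \<alpha> g x0 w x lg \<longleftrightarrow>
     x 0 = x0 \<and>
     (\<forall>k. subproblem_solution (\<chi> i. g i (x k) (w k)) (lg k) \<and>
          x (Suc k) = closest_point X (x k - \<alpha> k *\<^sub>R combination (\<chi> i. g i (x k) (w k)) (lg k)))"

end

theory Submission
  imports Defs
begin

text \<open>
  Expanding the projected step and bounding the inexactness of the multi-gradient pathwise by
  \<open>norm (u - s) \<le> (1 + \<beta> * MS) * (\<Sum>i. norm (g i - grad i))\<close>, where \<open>u\<close> is the stochastic and \<open>s\<close> the
  true multi-gradient, gives a one-step descent inequality for every realization of the samples.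
  The moment bounds enter only afterwards, when the inequality is integrated using the independence
  of \<open>x k\<close> and \<open>w k\<close>; with \<open>\<alpha> k = 2 / (c * (k + 1))\<close> the resulting recursion, weighted by \<open>k\<close>,
  telescopes. The solution map is only given on the arbitrary set \<open>T\<close>; measurability of the iterates
  comes from extending it to the closure of \<open>T\<close> by Lipschitz continuity.
\<close>

section \<open>Norm estimates for combinations and the unit simplex\<close>

lemma norm_combination_le: "norm (combination v l) \<le> norm l * norm v"
proof -
  have "norm (combination v l) \<le> (\<Sum>i\<in>UNIV. \<bar>l $ i\<bar> * \<bar>norm (v $ i)\<bar>)"
    unfolding combination_def by (rule order_trans[OF norm_sum]) simp
  also have "\<dots> \<le> L2_set (\<lambda>i. l $ i) UNIV * L2_set (\<lambda>i. norm (v $ i)) UNIV"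
    by (rule L2_set_mult_ineq)
  also have "\<dots> = norm l * norm v"
    by (simp add: norm_vec_def L2_set_def)
  finally show ?thesis .
qed

lemma norm_le_sum_norm_component: "norm v \<le> (\<Sum>i\<in>UNIV. norm (v $ i))"
  by (simp add: norm_vec_def L2_set_le_sum)

text \<open>Separates a change of the vectors from a change of the weights. The weights
  \<open>l\<close> stay with the vector error and the unperturbed \<open>v'\<close> with the weight
  error, so that \<open>l\<close> in the simplex and a bound on \<open>v'\<close> control the two
  terms.\<close>

lemma combination_diff:
  "combination v l - combination v' l' = combination (v - v') l + combination v' (l - l')"
  by (simp add: combination_def scaleR_diff_left scaleR_diff_right sum_subtractf)

lemma unit_simplex_component: "0 \<le> l $ i \<and> l $ i \<le> 1" if "l \<in> unit_simplex"
  using that member_le_sum[of i UNIV "\<lambda>i. l $ i"] by (auto simp: unit_simplex_def)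

lemma norm_unit_simplex_le_1: "norm l \<le> 1" if "l \<in> unit_simplex"
proof -
  have "norm l \<le> (\<Sum>i\<in>UNIV. \<bar>l $ i\<bar>)"
    by (rule norm_le_l1_cart)
  also have "\<dots> = 1"
    using that by (simp add: unit_simplex_def)
  finally show ?thesis .
qed

lemma norm_combination_simplex_le: "norm (combination v l) \<le> norm v" if "l \<in> unit_simplex"
  using norm_combination_le[of v l] norm_unit_simplex_le_1[OF that]
    mult_right_mono[of "norm l" 1 "norm v"] by simp

lemma convex_comb_unit_simplex:
  assumes "finite A" "\<And>s. s \<in> A \<Longrightarrow> l s \<in> unit_simplex"
    and "\<And>s. s \<in> A \<Longrightarrow> 0 \<le> u s" "sum u A = 1"
  shows "(\<Sum>s\<in>A. u s *\<^sub>R l s) \<in> unit_simplex"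
proof -
  have "(\<Sum>i\<in>UNIV. \<Sum>s\<in>A. u s * l s $ i) = (\<Sum>s\<in>A. u s * (\<Sum>i\<in>UNIV. l s $ i))"
    by (subst sum.swap) (simp add: sum_distrib_left)
  also have "\<dots> = 1"
    using assms by (simp add: unit_simplex_def)
  finally show ?thesis
    using assms by (auto simp: unit_simplex_def intro!: sum_nonneg)
qed

section \<open>Scalarized objective and the deterministic descent recursion\<close>

lemma scalarization_sum:
  "scalarization f y (\<Sum>s\<in>A. u s *\<^sub>R l s) = (\<Sum>s\<in>A. u s * scalarization f y (l s))"
  by (simp add: scalarization_def sum_distrib_left sum_distrib_right mult.assoc) (rule sum.swap)

text \<open>Average of the strong convexity inequalities at \<open>p\<close> with the weights
  \<open>l\<close>. Each modulus \<open>cs i\<close> is first lowered to \<open>c\<close>; the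
  weights sum to 1 and so leave the common quadratic term unchanged.\<close>

lemma scalarization_strong_convex:
  fixes grad :: "'m::finite \<Rightarrow> real ^ 'n::finite \<Rightarrow> real ^ 'n"
  assumes "l \<in> unit_simplex" "\<And>i. c \<le> cs i"
    and "\<And>i. f i p \<ge> f i y + grad i y \<bullet> (p - y) + cs i / 2 * (norm (p - y))\<^sup>2"
  shows "scalarization f y l - scalarization f p l
    \<le> combination (\<chi> i. grad i y) l \<bullet> (y - p) - c / 2 * (norm (y - p))\<^sup>2"
proof -
  have "f i y - f i p \<le> grad i y \<bullet> (y - p) - c / 2 * (norm (y - p))\<^sup>2" for i
  proof -
    have "c / 2 * (norm (y - p))\<^sup>2 \<le> cs i / 2 * (norm (y - p))\<^sup>2"
      using assms(2)[of i] by (intro mult_right_mono) auto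
    then show ?thesis
      using assms(3)[of i] by (simp add: norm_minus_commute inner_diff_right)
  qed
  then have "(\<Sum>i\<in>UNIV. l $ i * (f i y - f i p))
    \<le> (\<Sum>i\<in>UNIV. l $ i * (grad i y \<bullet> (y - p) - c / 2 * (norm (y - p))\<^sup>2))"
    using unit_simplex_component[OF assms(1)] by (intro sum_mono mult_left_mono) auto
  also have "\<dots> = combination (\<chi> i. grad i y) l \<bullet> (y - p)
      - (\<Sum>i\<in>UNIV. l $ i) * (c / 2 * (norm (y - p))\<^sup>2)"
    by (simp add: combination_def inner_sum_left sum_distrib_right right_diff_distrib sum_subtractf)
  finally show ?thesis
    using assms(1) by (simp add: scalarization_def unit_simplex_def right_diff_distrib sum_subtractf)
qed

text \<open>\<open>u\<close> is the direction taken, \<open>s\<close> the ideal one. The projection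
  is nonexpansive and fixes \<open>p\<close>, so it suffices to expand the square of the unprojected
  step. Replacing \<open>u\<close> by \<open>s\<close> in the cross term costs at most
  \<open>norm (u - s) * \<Theta>\<close> by Cauchy-Schwarz; the hypothesis on \<open>d\<close> then
  yields both the contraction and the decrease.\<close>

lemma projected_step_descent:
  fixes X :: "'x::euclidean_space set"
  assumes "closed X" "convex X" "p \<in> X" "0 \<le> a" "norm (y - p) \<le> \<Theta>"
    and "d \<le> s \<bullet> (y - p) - c / 2 * (norm (y - p))\<^sup>2"
  shows "(norm (closest_point X (y - a *\<^sub>R u) - p))\<^sup>2
    \<le> (1 - a * c) * (norm (y - p))\<^sup>2 + a\<^sup>2 * (norm u)\<^sup>2 + 2 * a * \<Theta> * norm (u - s) - 2 * a * d"
proof -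
  have "norm (closest_point X (y - a *\<^sub>R u) - p) \<le> norm (y - a *\<^sub>R u - p)"
    using closest_point_lipschitz[of X "y - a *\<^sub>R u" p] closest_point_self[of p X] assms
    by (auto simp: dist_norm)
  then have "(norm (closest_point X (y - a *\<^sub>R u) - p))\<^sup>2 \<le> (norm ((y - p) - a *\<^sub>R u))\<^sup>2"
    by (simp add: algebra_simps)
  also have "\<dots> = (norm (y - p))\<^sup>2 - 2 * a * (u \<bullet> (y - p)) + a\<^sup>2 * (norm u)\<^sup>2"
    unfolding power2_norm_eq_inner
    by (simp add: inner_diff inner_add inner_commute power2_eq_square algebra_simps)
  also have "\<dots> = (norm (y - p))\<^sup>2 + a\<^sup>2 * (norm u)\<^sup>2
      + 2 * a * (- ((u - s) \<bullet> (y - p)) - s \<bullet> (y - p))"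
    by (simp add: inner_diff algebra_simps)
  also have "\<dots> \<le> (norm (y - p))\<^sup>2 + a\<^sup>2 * (norm u)\<^sup>2
      + 2 * a * (norm (u - s) * \<Theta> - d - c / 2 * (norm (y - p))\<^sup>2)"
  proof -
    have "- ((u - s) \<bullet> (y - p)) \<le> norm (u - s) * norm (y - p)"
      using Cauchy_Schwarz_ineq2[of "u - s" "y - p"] by linarith
    also have "\<dots> \<le> norm (u - s) * \<Theta>"
      using assms by (intro mult_left_mono) auto
    finally have "- ((u - s) \<bullet> (y - p)) - s \<bullet> (y - p)
        \<le> norm (u - s) * \<Theta> - d - c / 2 * (norm (y - p))\<^sup>2"
      using assms by linarith
    then show ?thesis
      using assms by (intro add_left_mono mult_left_mono) auto
  qed
  also have "\<dots> = (1 - a * c) * (norm (y - p))\<^sup>2 + a\<^sup>2 * (norm u)\<^sup>2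
      + 2 * a * \<Theta> * norm (u - s) - 2 * a * d"
    by (simp add: algebra_simps)
  finally show ?thesis .
qed

text \<open>Weighting the step \<open>s\<close> by \<open>s / (2 * \<alpha> s)\<close> makes the squared distances telescope.\<close>

lemma weighted_sum_telescope:
  fixes a d :: "nat \<Rightarrow> real"
  assumes "c > 0" "K \<ge> 0" "\<And>s. 0 \<le> a s" "\<And>s. \<alpha> s = 2 / (c * (real s + 1))"
    and step: "\<And>s. a (Suc s) \<le> (1 - \<alpha> s * c) * a s + (\<alpha> s)\<^sup>2 * K - 2 * \<alpha> s * d s"
  shows "(\<Sum>s=1..k. real s * d s) \<le> real k * K / c"
proof -
  \<comment> \<open>The extra summand carries the induction: its coefficient is
    \<open>real k / (2 * \<alpha> k)\<close>. It vanishes at \<open>k = 0\<close>, so no initial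
    distance enters the bound, and it is dropped at the end because \<open>a\<close> is
    nonnegative.\<close>
  have "(\<Sum>s=1..k. real s * d s) + c * real k * (real k + 1) / 4 * a (Suc k) \<le> real k * K / c"
  proof (induction k)
    case (Suc k)
    define r where "r = real (Suc k)"
    have r: "r \<ge> 1" "real k = r - 1"
      by (simp_all add: r_def)
    have "c * r * (r + 1) / 4 * a (Suc (Suc k))
        \<le> c * r * (r + 1) / 4 * ((1 - \<alpha> (Suc k) * c) * a (Suc k) + (\<alpha> (Suc k))\<^sup>2 * K
          - 2 * \<alpha> (Suc k) * d (Suc k))"
      using assms(1) r by (intro mult_left_mono step) auto
    \<comment> \<open>Since \<open>1 - \<alpha> (Suc k) * c = (r - 1) / (r + 1)\<close>, the new
      weight \<open>c * r * (r + 1) / 4\<close> turns into the weight of the induction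
      hypothesis.\<close>
    also have "\<dots> = c * (r - 1) * r / 4 * a (Suc k) + r / (c * (r + 1)) * K - r * d (Suc k)"
      using assms(1) r(1) unfolding assms(4) r_def[symmetric]
      by (simp add: divide_simps power2_eq_square) (simp add: algebra_simps)
    also have "r / (c * (r + 1)) * K \<le> K / c"
    proof -
      have "r / (r + 1) * (K / c) \<le> 1 * (K / c)"
        using assms(1,2) r(1) by (intro mult_right_mono) auto
      then show ?thesis
        by (simp add: mult.commute)
    qed
    finally have "c * r * (r + 1) / 4 * a (Suc (Suc k))
        \<le> c * (r - 1) * r / 4 * a (Suc k) + K / c - r * d (Suc k)"
      by simp
    moreover have "(\<Sum>s=1..k. real s * d s) + c * (r - 1) * r / 4 * a (Suc k) \<le> (r - 1) * K / c"
      using Suc by (simp add: r(2))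
    moreover have "(r - 1) * K / c + K / c = r * K / c"
      by (simp add: left_diff_distrib diff_divide_distrib)
    moreover have "(\<Sum>s=1..Suc k. real s * d s) = (\<Sum>s=1..k. real s * d s) + r * d (Suc k)"
      by (simp add: r_def)
    ultimately show ?case
      unfolding r_def[symmetric] by linarith
  qed simp
  moreover have "0 \<le> c * real k * (real k + 1) / 4 * a (Suc k)"
    using assms by simp
  ultimately show ?thesis
    by linarith
qed

section \<open>Measurability of tuples, combinations and Lipschitz maps\<close>

lemma borel_measurable_vec_lambda [measurable (raw)]:
  fixes F :: "'m::finite \<Rightarrow> 'a \<Rightarrow> 'b::euclidean_space"
  assumes "\<And>i. F i \<in> borel_measurable M"
  shows "(\<lambda>x. \<chi> i. F i x) \<in> borel_measurable M"
  using assms by (subst borel_measurable_euclidean_space) (auto simp: Basis_vec_def inner_axis)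

lemma borel_measurable_combination [measurable (raw)]:
  fixes v :: "'a \<Rightarrow> (real ^ 'n::finite) ^ 'm::finite"
  assumes "v \<in> borel_measurable M" "l \<in> borel_measurable M"
  shows "(\<lambda>x. combination (v x) (l x)) \<in> borel_measurable M"
proof -
  have "(\<lambda>x. v x $ i) \<in> borel_measurable M" "(\<lambda>x. l x $ i) \<in> borel_measurable M" for i
    using assms by (auto intro!: borel_measurable_continuous_on[where f="\<lambda>x. x $ i"] continuous_intros)
  then show ?thesis
    unfolding combination_def by measurable
qed

text \<open>\<open>T\<close> may fail to be Borel, but its closure is closed and the target is
  complete, so \<open>h\<close> extends continuously to a Borel set; the value 0 outside keeps the
  extension measurable.\<close>

lemma lipschitz_on_measurable_extension:
  fixes h :: "'a::metric_space \<Rightarrow> 'b::{complete_space, real_normed_vector}"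
  assumes "C-lipschitz_on T h"
  obtains h' where "h' \<in> borel_measurable borel" "\<And>x. x \<in> T \<Longrightarrow> h' x = h x"
proof -
  obtain h' where "C-lipschitz_on (closure T) h'" and eq: "\<forall>x\<in>T. h' x = h x"
    using lipschitz_extend_closure[OF assms] by blast
  then have "(\<lambda>x. indicator (closure T) x *\<^sub>R h' x) \<in> borel_measurable borel"
    by (intro borel_measurable_continuous_on_indicator lipschitz_on_continuous_on) auto
  moreover have "indicator (closure T) x *\<^sub>R h' x = h x" if "x \<in> T" for x
    using that eq closure_subset by (auto simp: indicator_def)
  ultimately show thesis
    using that by blast
qed

section \<open>Independence of the current iterate and the current sample\<close>

context prob_space
begin

text \<open>The library's \<open>indep_var\<close> forces both variables to have the same type, so independence is
  expressed by the joint distribution.\<close>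

lemma joint_distr_recursive_sequence:
  assumes w: "indep_vars (\<lambda>_. D) w UNIV"
    and \<Phi>: "\<And>k. \<Phi> k \<in> N \<Otimes>\<^sub>M D \<rightarrow>\<^sub>M N"
    and x0: "x0 \<in> space N" "\<And>\<omega>. \<omega> \<in> space M \<Longrightarrow> x 0 \<omega> = x0"
    and step: "\<And>k \<omega>. \<omega> \<in> space M \<Longrightarrow> x (Suc k) \<omega> = \<Phi> k (x k \<omega>, w k \<omega>)"
  shows "x n \<in> M \<rightarrow>\<^sub>M N"
    and "distr M (N \<Otimes>\<^sub>M D) (\<lambda>\<omega>. (x n \<omega>, w n \<omega>)) = distr M N (x n) \<Otimes>\<^sub>M distr M D (w n)"
proof -
  \<comment> \<open>\<open>H k u\<close> is the iterate as a function of a sample sequence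
    \<open>u\<close>; it reads only the entries of \<open>u\<close> below \<open>k\<close>.\<close>
  define H where "H = rec_nat (\<lambda>_. x0) (\<lambda>k r u. \<Phi> k (r u, u k))"
  have H: "H 0 = (\<lambda>_. x0)" "H (Suc k) = (\<lambda>u. \<Phi> k (H k u, u k))" for k
    by (simp_all add: H_def)
  \<comment> \<open>The index set \<open>{..<n}\<close> stays fixed while \<open>k\<close> runs up
    to \<open>n\<close>, so that all \<open>H k\<close> live on one product space.\<close>
  let ?D = "\<lambda>A. PiM A (\<lambda>_. D)"
  have meas: "H k \<in> ?D {..<n} \<rightarrow>\<^sub>M N" if "k \<le> n" for k
    using that
  proof (induction k)
    case (Suc k)
    then have "(\<lambda>u. (H k u, u k)) \<in> ?D {..<n} \<rightarrow>\<^sub>M N \<Otimes>\<^sub>M D"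
      by (intro measurable_Pair) auto
    then show ?case
      unfolding H(2) by (rule measurable_compose[OF _ \<Phi>])
  qed (simp add: H(1) x0)
  have eq: "x k \<omega> = H k (\<lambda>i\<in>{..<n}. w i \<omega>)" if "\<omega> \<in> space M" "k \<le> n" for k \<omega>
    using that(2)
  proof (induction k)
    case (Suc k)
    then show ?case
      using step[OF that(1), of k] by (simp add: H(2))
  qed (simp add: H(1) x0 that)
  note H_meas [measurable] = meas[OF order_refl]
  let ?W = "\<lambda>A \<omega>. \<lambda>i\<in>A. w i \<omega>"
  have [measurable]: "w i \<in> M \<rightarrow>\<^sub>M D" for i
    using w by (simp add: indep_vars_def2)
  have W_meas [measurable]: "?W A \<in> M \<rightarrow>\<^sub>M ?D A" for A
    by measurable
  show "x n \<in> M \<rightarrow>\<^sub>M N"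
    using measurable_cong[of M "x n" "\<lambda>\<omega>. H n (?W {..<n} \<omega>)" N] eq by simp
  interpret W: prob_space "distr M D (w n)"
    by (rule prob_space_distr) measurable
  \<comment> \<open>The past samples and the current one are blocks over disjoint index sets. The
    current sample appears as a block over the singleton \<open>{n}\<close>, from which evaluation
    at \<open>n\<close> recovers it.\<close>
  have ind: "distr M (?D {..<n}) (?W {..<n}) \<Otimes>\<^sub>M distr M (?D {n}) (?W {n})
      = distr M (?D {..<n} \<Otimes>\<^sub>M ?D {n}) (\<lambda>\<omega>. (?W {..<n} \<omega>, ?W {n} \<omega>))"
    using indep_var_restrict[OF w, of "{..<n}" "{n}"] unfolding indep_var_distribution_eq by simp
  have w_distr: "distr (distr M (?D {n}) (?W {n})) D (\<lambda>u. u n) = distr M D (w n)"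
    by (subst distr_distr) (auto simp: comp_def)
  have "distr M N (x n) = distr M N (\<lambda>\<omega>. H n (?W {..<n} \<omega>))"
    using eq by (intro distr_cong) auto
  also have "\<dots> = distr (distr M (?D {..<n}) (?W {..<n})) N (H n)"
    by (subst distr_distr) (auto simp: comp_def)
  finally have "distr M N (x n) \<Otimes>\<^sub>M distr M D (w n)
      = distr (distr M (?D {..<n}) (?W {..<n})) N (H n)
        \<Otimes>\<^sub>M distr (distr M (?D {n}) (?W {n})) D (\<lambda>u. u n)"
    by (simp add: w_distr)
  also have "\<dots> = distr (distr M (?D {..<n}) (?W {..<n}) \<Otimes>\<^sub>M distr M (?D {n}) (?W {n}))
      (N \<Otimes>\<^sub>M D) (\<lambda>(u, v). (H n u, v n))"
    by (rule pair_measure_distr) (auto simp: w_distr W.sigma_finite_measure_axioms)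
  also have "\<dots> = distr M (N \<Otimes>\<^sub>M D) (\<lambda>\<omega>. (H n (?W {..<n} \<omega>), w n \<omega>))"
    unfolding ind by (subst distr_distr) (auto simp: comp_def)
  also have "\<dots> = distr M (N \<Otimes>\<^sub>M D) (\<lambda>\<omega>. (x n \<omega>, w n \<omega>))"
    using eq by (intro distr_cong) auto
  finally show "distr M (N \<Otimes>\<^sub>M D) (\<lambda>\<omega>. (x n \<omega>, w n \<omega>)) = distr M N (x n) \<Otimes>\<^sub>M distr M D (w n)" ..
qed

text \<open>Conditioning on \<open>Y\<close> by Tonelli: the joint law is a product, so the sample
  can be integrated first with \<open>Y\<close> held fixed. Nonnegativity of \<open>h\<close> allows
  this before integrability is known, and finiteness of the result then gives integrability.\<close>

lemma expectation_joint_distr_le: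
  fixes h :: "_ \<Rightarrow> real"
  assumes [measurable]: "Y \<in> M \<rightarrow>\<^sub>M N" "W \<in> M \<rightarrow>\<^sub>M D"
    and joint: "distr M (N \<Otimes>\<^sub>M D) (\<lambda>\<omega>. (Y \<omega>, W \<omega>)) = distr M N Y \<Otimes>\<^sub>M distr M D W"
    and W: "distr M D W = D"
    and h[measurable]: "h \<in> borel_measurable (N \<Otimes>\<^sub>M D)" and nonneg: "\<And>z. 0 \<le> h z"
    and bound: "AE \<omega> in M. integrable D (\<lambda>v. h (Y \<omega>, v)) \<and> (LINT v|D. h (Y \<omega>, v)) \<le> b"
  shows "integrable M (\<lambda>\<omega>. h (Y \<omega>, W \<omega>))" "expectation (\<lambda>\<omega>. h (Y \<omega>, W \<omega>)) \<le> b"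
proof -
  interpret D: prob_space D
    using prob_space_distr[of W D] W by simp
  \<comment> \<open>The bound holds almost everywhere on a probability space, hence at some point;
    this gives the sign needed to return from \<open>ennreal\<close> to the reals.\<close>
  have b: "0 \<le> b"
  proof -
    have "AE \<omega> in M. 0 \<le> b"
      using bound
    proof eventually_elim
      case (elim \<omega>)
      have "0 \<le> (LINT v|D. h (Y \<omega>, v))"
        by (intro Bochner_Integration.integral_nonneg nonneg)
      with elim show ?case
        by linarith
    qed
    then show ?thesis
      by simp
  qed
  have "(\<integral>\<^sup>+\<omega>. h (Y \<omega>, W \<omega>) \<partial>M) = (\<integral>\<^sup>+z. h z \<partial>distr M (N \<Otimes>\<^sub>M D) (\<lambda>\<omega>. (Y \<omega>, W \<omega>)))"
    by (subst nn_integral_distr) auto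
  also have "\<dots> = (\<integral>\<^sup>+z. h z \<partial>(distr M N Y \<Otimes>\<^sub>M D))"
    using joint W by simp
  also have "\<dots> = (\<integral>\<^sup>+y. \<integral>\<^sup>+v. h (y, v) \<partial>D \<partial>distr M N Y)"
    by (subst D.nn_integral_fst[symmetric]) auto
  also have "\<dots> = (\<integral>\<^sup>+\<omega>. \<integral>\<^sup>+v. h (Y \<omega>, v) \<partial>D \<partial>M)"
    by (subst nn_integral_distr) auto
  also have "\<dots> \<le> (\<integral>\<^sup>+\<omega>. ennreal b \<partial>M)"
  proof (rule nn_integral_mono_AE)
    show "AE \<omega> in M. (\<integral>\<^sup>+v. h (Y \<omega>, v) \<partial>D) \<le> ennreal b"
      using bound by eventually_elim (simp add: nn_integral_eq_integral nonneg ennreal_leI)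
  qed
  finally have le: "(\<integral>\<^sup>+\<omega>. h (Y \<omega>, W \<omega>) \<partial>M) \<le> ennreal b"
    by (simp add: emeasure_space_1)
  then show int: "integrable M (\<lambda>\<omega>. h (Y \<omega>, W \<omega>))"
    using nonneg by (intro integrableI_nonneg) (auto intro: le_less_trans)
  show "expectation (\<lambda>\<omega>. h (Y \<omega>, W \<omega>)) \<le> b"
    using le nn_integral_eq_integral[OF int] nonneg b by (simp add: ennreal_le_iff)
qed

end

theorem theorem5p1:
  fixes P :: "'a measure" and D :: "'w measure" and w :: "nat \<Rightarrow> 'a \<Rightarrow> 'w"
    and X :: "(real ^ 'n::finite) set"
    and fs :: "'m::finite \<Rightarrow> real ^ 'n \<Rightarrow> 'w \<Rightarrow> real"
    and f :: "'m \<Rightarrow> real ^ 'n \<Rightarrow> real"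
    and grad :: "'m \<Rightarrow> real ^ 'n \<Rightarrow> real ^ 'n"
    and g :: "'m \<Rightarrow> real ^ 'n \<Rightarrow> 'w \<Rightarrow> real ^ 'n"
    and \<alpha> :: "nat \<Rightarrow> real"
    and x0 z xstar :: "real ^ 'n"
    and x :: "nat \<Rightarrow> 'a \<Rightarrow> real ^ 'n"
    and sol :: "(real ^ 'n) ^ 'm \<Rightarrow> real ^ 'm"
    and lg lam lambar :: "nat \<Rightarrow> 'a \<Rightarrow> real ^ 'm"
    and T :: "((real ^ 'n) ^ 'm) set"
    and Ls C Chat Gs Ghat cs :: "'m \<Rightarrow> real"
    and \<Theta> \<beta> L c Mnabla M1 MF G GV LnablaS Lg MS :: real
    and k :: nat
  \<comment> \<open>problem and random samples\<close>
  assumes "CARD('m) \<ge> 2"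
    and "X \<noteq> {}" "closed X" "convex X"
    and "prob_space P" "prob_space D"
    and "prob_space.indep_vars P (\<lambda>_. D) w UNIV"
    and "\<And>k. distr P D (w k) = D"
    and "\<And>i y. integrable D (fs i y)"
    and "\<And>i y. f i y = (LINT v|D. fs i y v)"
    and "\<And>i. (\<lambda>(y, v). g i y v) \<in> borel_measurable (borel \<Otimes>\<^sub>M D)"
  \<comment> \<open>algorithm\<close>
    and "x0 \<in> X"
    and "\<And>\<omega>. \<omega> \<in> space P \<Longrightarrow>
           smg_run X \<alpha> g x0 (\<lambda>k. w k \<omega>) (\<lambda>k. x k \<omega>) (\<lambda>k. lg k \<omega>)"
    and "\<And>k \<omega>. \<omega> \<in> space P \<Longrightarrow> subproblem_solution (\<chi> i. grad i (x k \<omega>)) (lam k \<omega>)"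
  \<comment> \<open>Lipschitz gradients\<close>
    and "\<And>i y. GDERIV (f i) y :> grad i y"
    and "\<And>i. continuous_on UNIV (grad i)"
    and "\<And>i. Ls i > 0" "\<And>i. (Ls i)-lipschitz_on UNIV (grad i)"
    and "L = Max (range Ls)"
  \<comment> \<open>stochastic gradients\<close>
    and "\<And>i k. AE \<omega> in P. integrable D (g i (x k \<omega>)) \<and>
           (LINT v|D. g i (x k \<omega>) v) = grad i (x k \<omega>)"
    and "\<And>i. C i > 0" "\<And>i. Chat i > 0"
    and "\<And>i k. AE \<omega> in P. (LINT v|D. norm (g i (x k \<omega>) v - grad i (x k \<omega>)))
           \<le> \<alpha> k * (C i + Chat i * norm (grad i (x k \<omega>)))"
    and "\<And>i. Gs i > 0" "\<And>i. Ghat i > 0"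
    and "\<And>i k. AE \<omega> in P. integrable D (\<lambda>v. (norm (g i (x k \<omega>) v))\<^sup>2) \<and>
           vec_variance D (g i (x k \<omega>)) \<le> (Gs i)\<^sup>2 + (Ghat i)\<^sup>2 * (norm (grad i (x k \<omega>)))\<^sup>2"
  \<comment> \<open>bounded feasible region\<close>
    and "bounded X" "\<Theta> > 0" "\<And>y y'. y \<in> X \<Longrightarrow> y' \<in> X \<Longrightarrow> norm (y - y') \<le> \<Theta>"
  \<comment> \<open>Lipschitz continuity of the subproblem solution on the tuples that arise\<close>
    and "T = {(\<chi> i. grad i y) | y. y \<in> X} \<union>
             {(\<chi> i. g i (x k \<omega>) (w k \<omega>)) | k \<omega>. \<omega> \<in> space P}"
    and "\<And>v. v \<in> T \<Longrightarrow> subproblem_solution v (sol v)"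
    and "\<beta> > 0" "\<beta>-lipschitz_on T sol"
    and "\<And>k \<omega>. \<omega> \<in> space P \<Longrightarrow> lam k \<omega> = sol (\<chi> i. grad i (x k \<omega>))"
    and "\<And>k \<omega>. \<omega> \<in> space P \<Longrightarrow> lg k \<omega> = sol (\<chi> i. g i (x k \<omega>) (w k \<omega>))"
  \<comment> \<open>strong convexity\<close>
    and "\<And>i. cs i > 0"
    and "\<And>i y y'. f i y' \<ge> f i y + grad i y \<bullet> (y' - y) + cs i / 2 * (norm (y' - y))\<^sup>2"
    and "c = Min (range cs)"
  \<comment> \<open>constants\<close>
    and "z \<in> X" "Mnabla = Max (range (\<lambda>i. norm (grad i z)))"
    and "M1 = (\<Sum>i\<in>UNIV. C i)"
    and "MF = Max (range Chat)"
    and "G\<^sup>2 = CARD('m) * (\<Sum>i\<in>UNIV. (Gs i)\<^sup>2)"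
    and "GV\<^sup>2 = CARD('m) * Max (range (\<lambda>i. (Ghat i)\<^sup>2 + 1))"
    and "LnablaS = M1 + CARD('m) * MF * (Mnabla + L * \<Theta>)"
    and "Lg\<^sup>2 = G\<^sup>2 + CARD('m) * GV\<^sup>2 * (Mnabla + L * \<Theta>)\<^sup>2"
    and "MS = sqrt (CARD('m) * CARD('n)) * (Mnabla + L * \<Theta>)"
  \<comment> \<open>the claim\<close>
    and "xstar \<in> X"
    and "\<And>k. \<alpha> k = 2 / (c * (real k + 1))"
    and "\<And>k \<omega>. lambar k \<omega> = (\<Sum>s=1..k. (real s / (\<Sum>j=1..k. real j)) *\<^sub>R lam s \<omega>)"
    and "k \<ge> 1"
  shows "(\<forall>\<omega>\<in>space P. lambar k \<omega> \<in> unit_simplex) \<and>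
    Min ((\<lambda>s. LINT \<omega>|P. scalarization f (x s \<omega>) (lam s \<omega>)) ` {1..k})
      - (LINT \<omega>|P. scalarization f xstar (lambar k \<omega>))
    \<le> (2 * Lg\<^sup>2 + 4 * \<Theta> * (LnablaS + \<beta> * LnablaS * MS)) / (c * (real k + 1))"
proof -
  interpret prob_space P by fact
  interpret D: prob_space D by fact
  define B where "B = Mnabla + L * \<Theta>"
  define gt where "gt y = (\<chi> i. grad i y)" for y
  define st where "st y v = (\<chi> i. g i y v)" for y v
  define u where "u s \<omega> = combination (st (x s \<omega>) (w s \<omega>)) (lg s \<omega>)" for s \<omega>
  define dS where "dS s \<omega> = combination (gt (x s \<omega>)) (lam s \<omega>)" for s \<omega>
  \<comment> \<open>\<open>h1\<close> (gradient errors) and \<open>h2\<close> (squared gradients)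
    are nonnegative functions of iterate and sample that dominate the random terms of a step, so
    only their expectations have to be bounded.\<close>
  define h1 where "h1 = (\<lambda>(y, v). \<Sum>i\<in>UNIV. norm (g i y v - grad i y))"
  define h2 where "h2 = (\<lambda>(y, v). \<Sum>i\<in>UNIV. (norm (g i y v))\<^sup>2)"
  define d where
    "d s \<omega> = scalarization f (x s \<omega>) (lam s \<omega>) - scalarization f xstar (lam s \<omega>)" for s \<omega>
  define q where "q s \<omega> = (norm (x s \<omega> - xstar))\<^sup>2" for s \<omega>
  define K where "K = Lg\<^sup>2 + 2 * \<Theta> * (LnablaS + \<beta> * LnablaS * MS)"

  \<comment> \<open>Signs of the constants and gradient bounds on \<open>X\<close>\<close>
  have L: "Ls i \<le> L" and c_le: "c \<le> cs i" and Mnabla: "norm (grad i z) \<le> Mnabla"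
    and MF: "Chat i \<le> MF" and GV: "CARD('m) * ((Ghat i)\<^sup>2 + 1) \<le> GV\<^sup>2" for i
    unfolding assms(19,38,40,42,44)
    by (auto intro!: Max_ge Min_le mult_left_mono)
  have c: "c > 0"
    unfolding assms(38) using assms(36) by (subst Min_gr_iff) auto
  have \<alpha>: "\<alpha> s > 0" for s
    using c assms(49) by simp
  have L_nonneg: "0 \<le> L"
    using less_imp_le[OF assms(17)] L order_trans by blast
  have MF_nonneg: "0 \<le> MF"
    using less_imp_le[OF assms(22)] MF order_trans by blast
  have "0 \<le> Mnabla"
    using Mnabla norm_ge_zero order_trans by blast
  then have B: "0 \<le> B"
    using L_nonneg \<open>\<Theta> > 0\<close> by (simp add: B_def)
  have grad_le: "norm (grad i y) \<le> B" if "y \<in> X" for i y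
  proof -
    have "norm (grad i y - grad i z) \<le> Ls i * norm (y - z)"
      using lipschitz_onD[OF assms(18)[of i], of y z] by (simp add: dist_norm)
    also have "\<dots> \<le> L * \<Theta>"
      using L assms(29)[OF that \<open>z \<in> X\<close>] L_nonneg by (intro mult_mono) auto
    finally show ?thesis
      using Mnabla[of i] norm_triangle_sub[of "grad i y" "grad i z"] by (simp add: B_def)
  qed
  have M1: "0 < M1"
    unfolding assms(41) using assms(21) by (intro sum_pos) auto
  have LnablaS: "LnablaS = M1 + CARD('m) * MF * B"
    using assms(45) by (simp add: B_def)
  then have LnablaS_nonneg: "0 \<le> LnablaS"
    using M1 MF_nonneg B by simp
  have MS: "MS = sqrt (CARD('m) * CARD('n)) * B"
    using assms(47) by (simp add: B_def)
  then have MS_nonneg: "0 \<le> MS"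
    using B by simp
  have gt_le: "norm (gt y) \<le> MS" if "y \<in> X" for y
  proof -
    have "norm (gt y) \<le> sqrt (\<Sum>i\<in>(UNIV::'m set). B\<^sup>2)"
      using grad_le[OF that] unfolding norm_vec_def[of "gt y"] L2_set_def
      by (intro real_sqrt_le_mono sum_mono power_mono) (auto simp: gt_def)
    also have "\<dots> = sqrt (CARD('m)) * B"
      using B by (simp add: real_sqrt_mult)
    also have "\<dots> \<le> MS"
    proof -
      have "1 \<le> CARD('n)"
        using zero_less_card_finite[where 'a='n] by linarith
      then have "real CARD('m) * 1 \<le> real CARD('m) * real CARD('n)"
        by (intro mult_left_mono) auto
      then show ?thesis
        unfolding MS using B by (intro mult_right_mono real_sqrt_le_mono) auto
    qed
    finally show ?thesis .
  qed
  have K: "0 \<le> K"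
    unfolding K_def using \<open>\<Theta> > 0\<close> LnablaS_nonneg MS_nonneg \<open>\<beta> > 0\<close> by simp

  \<comment> \<open>Feasibility of the iterates and multipliers along each run\<close>
  have run: "x 0 \<omega> = x0" "lg s \<omega> \<in> unit_simplex"
      "x (Suc s) \<omega> = closest_point X (x s \<omega> - \<alpha> s *\<^sub>R u s \<omega>)"
    if "\<omega> \<in> space P" for \<omega> s
    using assms(13)[OF that]
    by (auto simp: smg_run_def subproblem_solution_def is_arg_min_def u_def st_def)
  have x_in: "x s \<omega> \<in> X" if "\<omega> \<in> space P" for \<omega> s
    using run[OF that] \<open>x0 \<in> X\<close> closest_point_in_set[OF \<open>closed X\<close> \<open>X \<noteq> {}\<close>]
    by (cases s) auto
  have lam_in: "lam s \<omega> \<in> unit_simplex" if "\<omega> \<in> space P" for \<omega> s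
    using assms(14)[OF that] by (auto simp: subproblem_solution_def is_arg_min_def)
  have T: "gt (x s \<omega>) \<in> T" "st (x s \<omega>) (w s \<omega>) \<in> T" if "\<omega> \<in> space P" for \<omega> s
    using that x_in[OF that] unfolding assms(30) gt_def st_def by blast+

  \<comment> \<open>Measurability of the run and joint law of iterate and sample\<close>
  obtain sol' where [measurable]: "sol' \<in> borel_measurable borel"
      and sol': "\<And>v. v \<in> T \<Longrightarrow> sol' v = sol v"
    using lipschitz_on_measurable_extension[OF assms(33)] by metis
  have lg: "lg s \<omega> = sol' (st (x s \<omega>) (w s \<omega>))" and lam: "lam s \<omega> = sol' (gt (x s \<omega>))"
    if "\<omega> \<in> space P" for \<omega> s
    using assms(34,35)[OF that] sol' T[OF that] by (simp_all add: gt_def st_def)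

  have g_meas [measurable]: "(\<lambda>p. g i (fst p) (snd p)) \<in> borel_measurable (borel \<Otimes>\<^sub>M D)" for i
    using assms(11)[of i] by (simp add: case_prod_beta')
  have grad_meas [measurable]: "grad i \<in> borel_measurable borel" for i
    by (rule borel_measurable_continuous_onI) fact
  have [measurable]: "closest_point X \<in> borel_measurable borel"
    by (intro borel_measurable_continuous_onI continuous_on_closest_point) fact+
  have [measurable]: "gt \<in> borel_measurable borel"
    unfolding gt_def by measurable
  have st_meas [measurable]: "(\<lambda>p. st (fst p) (snd p)) \<in> borel_measurable (borel \<Otimes>\<^sub>M D)"
    unfolding st_def by measurable
  have h_meas [measurable]: "h1 \<in> borel_measurable (borel \<Otimes>\<^sub>M D)"
      "h2 \<in> borel_measurable (borel \<Otimes>\<^sub>M D)"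
    unfolding h1_def h2_def case_prod_beta' by measurable
  \<comment> \<open>One step of the algorithm as a map of iterate and sample. With
    \<open>sol'\<close> in place of \<open>sol\<close> it is measurable everywhere, and it agrees
    with the run because the tuples met there lie in \<open>T\<close>.\<close>
  define \<Phi> where "\<Phi> s p = closest_point X (fst p - \<alpha> s *\<^sub>R
    combination (st (fst p) (snd p)) (sol' (st (fst p) (snd p))))" for s p
  have \<Phi>: "\<Phi> s \<in> borel_measurable (borel \<Otimes>\<^sub>M D)" for s
    unfolding \<Phi>_def by measurable
  have "x (Suc s) \<omega> = \<Phi> s (x s \<omega>, w s \<omega>)" if "\<omega> \<in> space P" for s \<omega>
    using run(3)[OF that] lg[OF that] by (simp add: u_def \<Phi>_def)
  note recursive = joint_distr_recursive_sequence[OF assms(7) \<Phi> _ run(1) this]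
  have x_meas [measurable]: "x s \<in> borel_measurable P" for s
    by (rule recursive(1)) simp
  have joint: "distr P (borel \<Otimes>\<^sub>M D) (\<lambda>\<omega>. (x s \<omega>, w s \<omega>))
      = distr P borel (x s) \<Otimes>\<^sub>M distr P D (w s)" for s
    by (rule recursive(2)) simp
  have w_meas [measurable]: "w s \<in> P \<rightarrow>\<^sub>M D" for s
    using assms(7) by (simp add: indep_vars_def2)
  have xw_meas [measurable]: "(\<lambda>\<omega>. st (x s \<omega>) (w s \<omega>)) \<in> borel_measurable P" for s
    using measurable_compose[OF measurable_Pair[OF x_meas w_meas] st_meas] by simp
  have lam_meas [measurable]: "lam s \<in> borel_measurable P" for s
    using measurable_cong[of P "lam s" "\<lambda>\<omega>. sol' (gt (x s \<omega>))" borel] lam by simp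
  have lg_meas [measurable]: "lg s \<in> borel_measurable P" for s
    using measurable_cong[of P "lg s" "\<lambda>\<omega>. sol' (st (x s \<omega>) (w s \<omega>))" borel] lg by simp
  have [measurable]: "u s \<in> borel_measurable P" "dS s \<in> borel_measurable P" for s
    unfolding u_def dS_def by measurable

  \<comment> \<open>Moment bounds for a fixed iterate\<close>
  have h1_le: "AE \<omega> in P. integrable D (\<lambda>v. h1 (x s \<omega>, v)) \<and>
      (LINT v|D. h1 (x s \<omega>, v)) \<le> \<alpha> s * LnablaS" for s
  proof -
    have "AE \<omega> in P. \<forall>i. integrable D (g i (x s \<omega>)) \<and>
        (LINT v|D. norm (g i (x s \<omega>) v - grad i (x s \<omega>)))
          \<le> \<alpha> s * (C i + Chat i * norm (grad i (x s \<omega>)))"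
      using assms(20,23) by (auto simp: AE_all_countable AE_conj_iff)
    then show ?thesis
      using AE_space
    proof eventually_elim
      case (elim \<omega>)
      then have int: "integrable D (\<lambda>v. norm (g i (x s \<omega>) v - grad i (x s \<omega>)))" for i
        by auto
      have "(LINT v|D. h1 (x s \<omega>, v))
          = (\<Sum>i\<in>UNIV. LINT v|D. norm (g i (x s \<omega>) v - grad i (x s \<omega>)))"
        unfolding h1_def using int by simp
      also have "\<dots> \<le> (\<Sum>i\<in>UNIV. \<alpha> s * (C i + MF * B))"
      proof (rule sum_mono)
        fix i
        have "Chat i * norm (grad i (x s \<omega>)) \<le> MF * B"
          using MF MF_nonneg grad_le[OF x_in[OF elim(2)]] by (intro mult_mono) auto
        then have "\<alpha> s * (C i + Chat i * norm (grad i (x s \<omega>))) \<le> \<alpha> s * (C i + MF * B)"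
          using \<alpha>[of s] by simp
        with elim(1) show "(LINT v|D. norm (g i (x s \<omega>) v - grad i (x s \<omega>))) \<le> \<alpha> s * (C i + MF * B)"
          using order_trans by blast
      qed
      also have "\<dots> = \<alpha> s * LnablaS"
        unfolding LnablaS assms(41) by (simp add: sum.distrib flip: sum_distrib_left)
      finally show ?case
        using int by (simp add: h1_def)
    qed
  qed
  have h2_le: "AE \<omega> in P. integrable D (\<lambda>v. h2 (x s \<omega>, v)) \<and>
      (LINT v|D. h2 (x s \<omega>, v)) \<le> Lg\<^sup>2" for s
  proof -
    have "AE \<omega> in P. \<forall>i. (LINT v|D. g i (x s \<omega>) v) = grad i (x s \<omega>) \<and>
        integrable D (\<lambda>v. (norm (g i (x s \<omega>) v))\<^sup>2) \<and>
        vec_variance D (g i (x s \<omega>)) \<le> (Gs i)\<^sup>2 + (Ghat i)\<^sup>2 * (norm (grad i (x s \<omega>)))\<^sup>2"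
      using assms(20,26) by (auto simp: AE_all_countable AE_conj_iff)
    then show ?thesis
      using AE_space
    proof eventually_elim
      case (elim \<omega>)
      have "(LINT v|D. h2 (x s \<omega>, v)) = (\<Sum>i\<in>UNIV. LINT v|D. (norm (g i (x s \<omega>) v))\<^sup>2)"
        unfolding h2_def using elim by simp
      also have "\<dots> \<le> (\<Sum>i\<in>UNIV. (Gs i)\<^sup>2 + ((Ghat i)\<^sup>2 + 1) * B\<^sup>2)"
      proof (rule sum_mono)
        fix i
        \<comment> \<open>The second moment is the variance plus the squared norm of the mean;
          unbiasedness makes the latter \<open>(norm (grad i (x s \<omega>)))\<^sup>2\<close>, which
          accounts for the summand 1.\<close>
        have "(LINT v|D. (norm (g i (x s \<omega>) v))\<^sup>2)
            \<le> (Gs i)\<^sup>2 + ((Ghat i)\<^sup>2 + 1) * (norm (grad i (x s \<omega>)))\<^sup>2"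
          using elim(1)[rule_format, of i] by (auto simp: vec_variance_def algebra_simps)
        also have "\<dots> \<le> (Gs i)\<^sup>2 + ((Ghat i)\<^sup>2 + 1) * B\<^sup>2"
          using grad_le[OF x_in[OF elim(2)]] by (intro add_left_mono mult_left_mono power_mono) auto
        finally show "(LINT v|D. (norm (g i (x s \<omega>) v))\<^sup>2) \<le> (Gs i)\<^sup>2 + ((Ghat i)\<^sup>2 + 1) * B\<^sup>2" .
      qed
      also have "\<dots> \<le> Lg\<^sup>2"
      proof -
        have m: "1 \<le> real CARD('m)"
          using assms(1) by simp
        have "(\<Sum>i\<in>UNIV. (Gs i)\<^sup>2) \<le> G\<^sup>2"
          unfolding assms(43) using m mult_right_mono[OF m, of "\<Sum>i\<in>UNIV. (Gs i)\<^sup>2"]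
          by (simp add: sum_nonneg)
        moreover have "(\<Sum>i\<in>UNIV. ((Ghat i)\<^sup>2 + 1) * B\<^sup>2) \<le> (\<Sum>i\<in>(UNIV::'m set). GV\<^sup>2 * B\<^sup>2)"
        proof (intro sum_mono mult_right_mono)
          show "(Ghat i)\<^sup>2 + 1 \<le> GV\<^sup>2" for i
            using GV[of i] mult_right_mono[OF m, of "(Ghat i)\<^sup>2 + 1"] by simp
        qed simp
        ultimately show ?thesis
          using assms(46) by (simp add: sum.distrib B_def)
      qed
      finally show ?case
        using elim by (simp add: h2_def)
    qed
  qed
  note h1_exp = expectation_joint_distr_le[OF x_meas w_meas joint assms(8) h_meas(1) _ h1_le]
  note h2_exp = expectation_joint_distr_le[OF x_meas w_meas joint assms(8) h_meas(2) _ h2_le]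
  have h_nonneg: "0 \<le> h1 p" "0 \<le> h2 p" for p
    by (auto simp: h1_def h2_def case_prod_beta' intro!: sum_nonneg)

  \<comment> \<open>Pathwise bounds on the step and on its error\<close>
  have u_le: "(norm (u s \<omega>))\<^sup>2 \<le> h2 (x s \<omega>, w s \<omega>)" if "\<omega> \<in> space P" for s \<omega>
  proof -
    have "(norm (u s \<omega>))\<^sup>2 \<le> (norm (st (x s \<omega>) (w s \<omega>)))\<^sup>2"
      unfolding u_def using norm_combination_simplex_le[OF run(2)[OF that]] by (intro power_mono) auto
    also have "\<dots> = h2 (x s \<omega>, w s \<omega>)"
      by (simp add: norm_vec_def L2_set_def sum_nonneg h2_def st_def)
    finally show ?thesis .
  qed
  \<comment> \<open>The vector error is weighted by \<open>lg\<close>, which lies in the simplex,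
    giving the 1. The multiplier error is at most \<open>\<beta> * norm ?e\<close> and acts on true
    gradients of norm at most \<open>MS\<close>, giving \<open>\<beta> * MS\<close>.\<close>
  have err_le: "norm (u s \<omega> - dS s \<omega>) \<le> (1 + \<beta> * MS) * h1 (x s \<omega>, w s \<omega>)"
    if "\<omega> \<in> space P" for s \<omega>
  proof -
    let ?e = "st (x s \<omega>) (w s \<omega>) - gt (x s \<omega>)"
    have e: "norm ?e \<le> h1 (x s \<omega>, w s \<omega>)"
      using norm_le_sum_norm_component[of ?e] by (simp add: h1_def st_def gt_def)
    have "norm (lg s \<omega> - lam s \<omega>) \<le> \<beta> * norm ?e"
      using lipschitz_onD[OF assms(33) T(2,1)[OF that], of s s] lg[OF that] lam[OF that] sol' T[OF that]
      by (simp add: dist_norm)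
    then have "norm (combination (gt (x s \<omega>)) (lg s \<omega> - lam s \<omega>)) \<le> (\<beta> * norm ?e) * MS"
      using gt_le[OF x_in[OF that]] \<open>\<beta> > 0\<close>
      by (intro order_trans[OF norm_combination_le] mult_mono) auto
    moreover have "norm (combination ?e (lg s \<omega>)) \<le> norm ?e"
      by (rule norm_combination_simplex_le) (rule run(2)[OF that])
    ultimately have "norm (u s \<omega> - dS s \<omega>) \<le> (1 + \<beta> * MS) * norm ?e"
      unfolding u_def dS_def combination_diff
      by (intro norm_triangle_le) (simp add: algebra_simps)
    also have "\<dots> \<le> (1 + \<beta> * MS) * h1 (x s \<omega>, w s \<omega>)"
      using e \<open>\<beta> > 0\<close> MS_nonneg by (intro mult_left_mono) auto
    finally show ?thesis .
  qed

  \<comment> \<open>Integrability of objective values and squared distances\<close>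
  have S_int: "integrable P (\<lambda>\<omega>. scalarization f (y \<omega>) (lam s \<omega>))"
    if [measurable]: "y \<in> borel_measurable P" and y: "\<And>\<omega>. \<omega> \<in> space P \<Longrightarrow> y \<omega> \<in> X" for s y
    unfolding scalarization_def
  proof (rule Bochner_Integration.integrable_sum)
    fix i
    have f_cont: "continuous_on A (f i)" for A
      using assms(15)[of i] by (intro has_derivative_continuous_on[where f'="\<lambda>y h. h \<bullet> grad i y"])
        (auto simp: gderiv_def intro: has_derivative_at_withinI)
    \<comment> \<open>Compactness of \<open>X\<close> bounds \<open>f i\<close> there; with weights
      in the unit interval the integrand is bounded, which suffices on a probability space.\<close>
    have "compact (f i ` X)"
      using assms(3,27) by (intro compact_continuous_image f_cont) (simp add: compact_eq_bounded_closed)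
    then obtain b where b: "\<And>y. y \<in> X \<Longrightarrow> \<bar>f i y\<bar> \<le> b"
      using compact_imp_bounded[of "f i ` X"] unfolding bounded_iff by auto
    have [measurable]: "f i \<in> borel_measurable borel"
      by (intro borel_measurable_continuous_onI f_cont)
    have [measurable]: "(\<lambda>\<omega>. lam s \<omega> $ i) \<in> borel_measurable P"
      by (intro borel_measurable_continuous_on[where f="\<lambda>x. x $ i"] continuous_intros) measurable
    have "\<bar>lam s \<omega> $ i * f i (y \<omega>)\<bar> \<le> 1 * b" if "\<omega> \<in> space P" for \<omega>
      unfolding abs_mult using b[OF y[OF that]] unit_simplex_component[OF lam_in[OF that]]
      by (intro mult_mono) auto
    then show "integrable P (\<lambda>\<omega>. lam s \<omega> $ i * f i (y \<omega>))"
      by (intro integrable_const_bound[where B=b]) (auto intro!: AE_I2)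
  qed
  have xs_int: "integrable P (\<lambda>\<omega>. scalarization f (x s \<omega>) (lam s \<omega>))" for s
    by (intro S_int x_meas x_in)
  have star_int: "integrable P (\<lambda>\<omega>. scalarization f xstar (lam s \<omega>))" for s
    using \<open>xstar \<in> X\<close> by (intro S_int) auto
  have d_int: "integrable P (d s)" for s
    unfolding d_def using xs_int star_int by simp
  have q_int: "integrable P (q s)" for s
  proof (rule integrable_const_bound[where B="\<Theta>\<^sup>2"])
    show "AE \<omega> in P. norm (q s \<omega>) \<le> \<Theta>\<^sup>2"
      using assms(29)[OF x_in \<open>xstar \<in> X\<close>] by (intro AE_I2) (auto simp: q_def intro!: power_mono)
  qed (unfold q_def, measurable)

  \<comment> \<open>Expected one-step inequality and its weighted sum\<close>
  have step: "expectation (q (Suc s))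
    \<le> (1 - \<alpha> s * c) * expectation (q s) + (\<alpha> s)\<^sup>2 * K - 2 * \<alpha> s * expectation (d s)" for s
  proof -
    let ?h1 = "\<lambda>\<omega>. h1 (x s \<omega>, w s \<omega>)" and ?h2 = "\<lambda>\<omega>. h2 (x s \<omega>, w s \<omega>)"
    let ?b = "2 * \<alpha> s * \<Theta> * (1 + \<beta> * MS)"
    have b: "0 \<le> ?b"
      using \<alpha>[of s] \<open>\<Theta> > 0\<close> \<open>\<beta> > 0\<close> MS_nonneg by simp
    have h1: "integrable P ?h1" "expectation ?h1 \<le> \<alpha> s * LnablaS"
      and h2: "integrable P ?h2" "expectation ?h2 \<le> Lg\<^sup>2"
      using h1_exp h2_exp h_nonneg by auto
    have "q (Suc s) \<omega> \<le> (1 - \<alpha> s * c) * q s \<omega> + (\<alpha> s)\<^sup>2 * ?h2 \<omega> + ?b * ?h1 \<omega> - 2 * \<alpha> s * d s \<omega>"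
      if \<omega>: "\<omega> \<in> space P" for \<omega>
    proof -
      have "d s \<omega> \<le> dS s \<omega> \<bullet> (x s \<omega> - xstar) - c / 2 * (norm (x s \<omega> - xstar))\<^sup>2"
        unfolding d_def dS_def gt_def
        by (rule scalarization_strong_convex[OF lam_in[OF \<omega>] c_le assms(37)])
      from projected_step_descent[OF \<open>closed X\<close> \<open>convex X\<close> \<open>xstar \<in> X\<close> less_imp_le[OF \<alpha>]
          assms(29)[OF x_in[OF \<omega>] \<open>xstar \<in> X\<close>] this]
      have "q (Suc s) \<omega> \<le> (1 - \<alpha> s * c) * q s \<omega> + (\<alpha> s)\<^sup>2 * (norm (u s \<omega>))\<^sup>2
          + 2 * \<alpha> s * \<Theta> * norm (u s \<omega> - dS s \<omega>) - 2 * \<alpha> s * d s \<omega>"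
        unfolding q_def run(3)[OF \<omega>] .
      moreover have "(\<alpha> s)\<^sup>2 * (norm (u s \<omega>))\<^sup>2 \<le> (\<alpha> s)\<^sup>2 * ?h2 \<omega>"
        using u_le[OF \<omega>] by (intro mult_left_mono) auto
      moreover have "2 * \<alpha> s * \<Theta> * norm (u s \<omega> - dS s \<omega>) \<le> 2 * \<alpha> s * \<Theta> * ((1 + \<beta> * MS) * ?h1 \<omega>)"
        using err_le[OF \<omega>] \<alpha>[of s] \<open>\<Theta> > 0\<close> by (intro mult_left_mono) auto
      ultimately show ?thesis
        by (simp add: mult.assoc)
    qed
    then have "expectation (q (Suc s)) \<le> expectation (\<lambda>\<omega>. (1 - \<alpha> s * c) * q s \<omega>
        + (\<alpha> s)\<^sup>2 * ?h2 \<omega> + ?b * ?h1 \<omega> - 2 * \<alpha> s * d s \<omega>)"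
      using q_int d_int h1(1) h2(1) by (intro integral_mono) auto
    also have "\<dots> = (1 - \<alpha> s * c) * expectation (q s) + (\<alpha> s)\<^sup>2 * expectation ?h2
        + ?b * expectation ?h1 - 2 * \<alpha> s * expectation (d s)"
      using q_int[of s] d_int[of s] h1(1) h2(1) by simp
    also have "\<dots> \<le> (1 - \<alpha> s * c) * expectation (q s) + (\<alpha> s)\<^sup>2 * Lg\<^sup>2
        + ?b * (\<alpha> s * LnablaS) - 2 * \<alpha> s * expectation (d s)"
      using b by (intro diff_right_mono add_mono order_refl mult_left_mono h1(2) h2(2)) auto
    \<comment> \<open>The first-moment bound brings a second factor \<open>\<alpha> s\<close>, so
      the inexactness of the direction has the same order \<open>(\<alpha> s)\<^sup>2\<close> as the
      second-moment term and both merge into \<open>K\<close>.\<close>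
    also have "\<dots> = (1 - \<alpha> s * c) * expectation (q s) + (\<alpha> s)\<^sup>2 * K - 2 * \<alpha> s * expectation (d s)"
      by (simp add: K_def power2_eq_square algebra_simps)
    finally show ?thesis .
  qed
  have telescoped: "(\<Sum>s=1..k. real s * expectation (d s)) \<le> real k * K / c"
    using c K assms(49) step
    by (intro weighted_sum_telescope[where a="\<lambda>s. expectation (q s)"]) (auto simp: q_def)

  \<comment> \<open>Averaging with the weights \<open>s / \<sigma>\<close>\<close>
  define \<sigma> where "\<sigma> = (\<Sum>j=1..k. real j)"
  have \<sigma>: "\<sigma> = real k * (real k + 1) / 2" "\<sigma> > 0"
    using \<open>k \<ge> 1\<close> double_gauss_sum_from_Suc_0[of k, where 'a=real] unfolding \<sigma>_def
    by (auto intro!: sum_pos)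
  have lambar: "lambar k \<omega> = (\<Sum>s=1..k. (real s / \<sigma>) *\<^sub>R lam s \<omega>)" for \<omega>
    using assms(50) by (simp add: \<sigma>_def)
  have simplex: "\<forall>\<omega>\<in>space P. lambar k \<omega> \<in> unit_simplex"
  proof
    fix \<omega> assume "\<omega> \<in> space P"
    moreover have "(\<Sum>s=1..k. real s / \<sigma>) = 1"
      using \<sigma>(2) by (simp add: \<sigma>_def flip: sum_divide_distrib)
    ultimately show "lambar k \<omega> \<in> unit_simplex"
      unfolding lambar using lam_in \<sigma>(2) by (intro convex_comb_unit_simplex) auto
  qed
  define S where "S s = expectation (\<lambda>\<omega>. scalarization f (x s \<omega>) (lam s \<omega>))" for s
  define R where "R s = expectation (\<lambda>\<omega>. scalarization f xstar (lam s \<omega>))" for s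
  have d_expectation: "expectation (d s) = S s - R s" for s
    unfolding d_def[abs_def] S_def R_def using xs_int star_int by simp
  \<comment> \<open>The point \<open>xstar\<close> is the same for all \<open>s\<close> and
    \<open>scalarization\<close> is linear in the weights, so the averaged multiplier yields exactly
    the average of the \<open>R s\<close>.\<close>
  have bar: "expectation (\<lambda>\<omega>. scalarization f xstar (lambar k \<omega>)) = (\<Sum>s=1..k. real s * R s) / \<sigma>"
    unfolding lambar scalarization_sum using star_int
    by (simp add: R_def sum_divide_distrib)
  \<comment> \<open>The minimum of the \<open>S s\<close> is at most their weighted average.\<close>
  have "\<sigma> * Min (S ` {1..k}) = (\<Sum>s=1..k. real s * Min (S ` {1..k}))"
    by (simp add: \<sigma>_def sum_distrib_right)
  also have "\<dots> \<le> (\<Sum>s=1..k. real s * S s)"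
    by (intro sum_mono mult_left_mono Min_le) auto
  also have "\<dots> = (\<Sum>s=1..k. real s * expectation (d s)) + (\<Sum>s=1..k. real s * R s)"
    by (simp add: d_expectation algebra_simps flip: sum.distrib)
  also have "\<dots> \<le> real k * K / c + (\<Sum>s=1..k. real s * R s)"
    using telescoped by simp
  finally have "\<sigma> * (Min (S ` {1..k}) - (\<Sum>s=1..k. real s * R s) / \<sigma>) \<le> real k * K / c"
    using \<sigma>(2) by (simp add: right_diff_distrib)
  then have "Min (S ` {1..k}) - (\<Sum>s=1..k. real s * R s) / \<sigma> \<le> (real k * K / c) / \<sigma>"
    by (subst pos_le_divide_eq[OF \<sigma>(2)]) (simp only: mult.commute)
  \<comment> \<open>The factor \<open>real k\<close> cancels against
    \<open>\<sigma> = real k * (real k + 1) / 2\<close>, leaving the rate of order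
    \<open>1 / (k + 1)\<close>.\<close>
  also have "\<dots> = 2 * K / (c * (real k + 1))"
  proof -
    have "real k \<noteq> 0" "real k + 1 \<noteq> 0" "c \<noteq> 0"
      using \<open>k \<ge> 1\<close> c by auto
    then show ?thesis
      unfolding \<sigma>(1) by (simp add: divide_simps)
  qed
  also have "\<dots> = (2 * Lg\<^sup>2 + 4 * \<Theta> * (LnablaS + \<beta> * LnablaS * MS)) / (c * (real k + 1))"
    by (simp add: K_def algebra_simps)
  finally show ?thesis
    using simplex bar by (simp add: S_def)
qed

end
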